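(* Let $G$ be a connected labeled semi-Hamiltonian graph with $V(G)=[n]$. Then $S/I_G$ is a complete intersection if and only if $G=L_n$.
   Context: All graphs are finite and simple. Let $\mathbb{K}$ be a field, $[n]=\{1,\ldots,n\}$ and $S=\mathbb{K}[x_1,\ldots,x_{n+1}]$. For $1\le i<j\le n$ put $g_{ij}=x_ix_{j+1}-x_jx_{i+1}$. For a graph $G$ with vertex set $[n]$, the Hankel edge ideal $I_G\subset S$ is the ideal generated by the $g_{ij}$ with $i<j$ and $\{i,j\}\in E(G)$. $L_n$ is the path with vertex set $[n]$ and edges $\{i,i+1\}$, $1\le i\le n-1$. A graph $G$ on $[n]$ is a labeled semi-Hamiltonian graph if $L_n$ is a subgraph of $G$ and $\{1,n\}\notin E(G)$. For a homogeneous ideal $I\subset S$, $\mu(I)$ is the cardinality of a minimal homogeneous generating set of $I$, and $S/I$ is a complete intersection if $\mu(I)=\operatorname{height} I$. *)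

theory Defs
  imports
    "HOL-Library.Poly_Mapping"
    "HOL-Library.Extended_Nat"
    "HOL-Algebra.Ideal"
    "Graph_Theory.Graph_Theory"
begin

section \<open>The polynomial ring \<open>\<bbbK>[x\<^sub>1, \<dots>, x\<^sub>n\<^sub>+\<^sub>1]\<close>\<close>

text \<open>
  A polynomial is a finitely supported map from exponent vectors to coefficients; the product of
  \<^theory>\<open>HOL-Library.Poly_Mapping\<close> is the convolution product, i.e. multiplication of polynomials.
\<close>

type_synonym 'k mpoly = "(nat \<Rightarrow>\<^sub>0 nat) \<Rightarrow>\<^sub>0 'k"

definition X :: "nat \<Rightarrow> 'k::field mpoly" where
  "X i = Poly_Mapping.single (Poly_Mapping.single i 1) 1"

definition poly_carrier :: "nat \<Rightarrow> 'k::field mpoly set" where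
  "poly_carrier n = {p. \<forall>m \<in> Poly_Mapping.keys p. Poly_Mapping.keys m \<subseteq> {1..n + 1}}"

definition poly_ring :: "nat \<Rightarrow> 'k::field mpoly ring" where
  "poly_ring n = \<lparr>carrier = poly_carrier n, monoid.mult = (*), one = 1, zero = 0, add = (+)\<rparr>"

lemma poly_carrier_mult:
  assumes "p \<in> poly_carrier n" "q \<in> poly_carrier n"
  shows "p * q \<in> poly_carrier n"
  unfolding poly_carrier_def
proof (intro CollectI ballI)
  fix m assume "m \<in> Poly_Mapping.keys (p * q)"
  then obtain a b where "a \<in> Poly_Mapping.keys p" "b \<in> Poly_Mapping.keys q" "m = a + b"
    using keys_mult[of p q] by blast
  then show "Poly_Mapping.keys m \<subseteq> {1..n + 1}"
    using assms keys_add[of a b] unfolding poly_carrier_def by blast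
qed

lemma poly_carrier_add:
  assumes "p \<in> poly_carrier n" "q \<in> poly_carrier n"
  shows "p + q \<in> poly_carrier n"
  using assms keys_add[of p q] unfolding poly_carrier_def by blast

lemma cring_poly_ring: "cring (poly_ring n :: 'k::field mpoly ring)"
proof (rule cringI)
  show "abelian_group (poly_ring n :: 'k mpoly ring)"
  proof (rule abelian_groupI)
    fix p assume "p \<in> carrier (poly_ring n :: 'k mpoly ring)"
    then have "- p \<in> carrier (poly_ring n)"
      by (simp add: poly_ring_def poly_carrier_def)
    then show "\<exists>q \<in> carrier (poly_ring n). q \<oplus>\<^bsub>poly_ring n\<^esub> p = \<zero>\<^bsub>poly_ring n\<^esub>"
      by (intro bexI[of _ "- p"]) (simp_all add: poly_ring_def)
  qed (auto simp: poly_ring_def poly_carrier_add ac_simps, simp add: poly_carrier_def)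
  show "comm_monoid (poly_ring n :: 'k mpoly ring)"
    by (rule comm_monoidI)
      (auto simp: poly_ring_def poly_carrier_mult ac_simps, simp add: poly_carrier_def)
qed (simp add: poly_ring_def algebra_simps)

definition monom_degree :: "(nat \<Rightarrow>\<^sub>0 nat) \<Rightarrow> nat" where
  "monom_degree m = (\<Sum>i \<in> Poly_Mapping.keys m. Poly_Mapping.lookup m i)"

definition homogeneous :: "'k::field mpoly \<Rightarrow> bool" where
  "homogeneous p \<longleftrightarrow> (\<exists>d. \<forall>m \<in> Poly_Mapping.keys p. monom_degree m = d)"


section \<open>Height and complete intersections\<close>

definition prime_height :: "('a, 'b) ring_scheme \<Rightarrow> 'a set \<Rightarrow> enat" where
  "prime_height R P = Sup {enat k | k. \<exists>C :: nat \<Rightarrow> 'a set.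
     (\<forall>i \<le> k. primeideal (C i) R) \<and> (\<forall>i < k. C i \<subset> C (Suc i)) \<and> C k = P}"

definition ideal_height :: "('a, 'b) ring_scheme \<Rightarrow> 'a set \<Rightarrow> enat" where
  "ideal_height R I = Inf {prime_height R P | P. primeideal P R \<and> I \<subseteq> P}"

definition min_homogeneous_generating_set ::
    "nat \<Rightarrow> 'k::field mpoly set \<Rightarrow> 'k mpoly set \<Rightarrow> bool" where
  "min_homogeneous_generating_set n I B \<longleftrightarrow>
     finite B \<and> B \<subseteq> carrier (poly_ring n) \<and> (\<forall>p \<in> B. homogeneous p) \<and>
     genideal (poly_ring n) B = I \<and> (\<forall>C. C \<subset> B \<longrightarrow> genideal (poly_ring n) C \<noteq> I)"

text \<open>
  All minimal homogeneous generating sets of a homogeneous ideal have the same cardinality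
  (graded Nakayama), and they are automatically finite; \<open>LEAST\<close> therefore only selects this common
  value. Finiteness is required above because \<^const>\<open>card\<close> is \<open>0\<close> on infinite sets.
\<close>

definition mu :: "nat \<Rightarrow> 'k::field mpoly set \<Rightarrow> nat" where
  "mu n I = (LEAST k. \<exists>B. min_homogeneous_generating_set n I B \<and> card B = k)"

definition complete_intersection :: "nat \<Rightarrow> 'k::field mpoly set \<Rightarrow> bool" where
  "complete_intersection n I \<longleftrightarrow> enat (mu n I) = ideal_height (poly_ring n) I"


section \<open>Graphs and Hankel edge ideals\<close>

text \<open>
  A finite simple graph is a \<^locale>\<open>pair_graph\<close>, i.e. a finite loop-free digraph with a symmetric arc
  relation; the undirected edge \<open>{i, j}\<close> is represented by the two arcs \<open>(i, j)\<close> and \<open>(j, i)\<close>.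
\<close>

definition path_graph :: "nat \<Rightarrow> nat pair_pre_digraph" where
  "path_graph n = \<lparr>pverts = {1..n},
     parcs = {(i, j). i \<in> {1..n} \<and> j \<in> {1..n} \<and> (j = i + 1 \<or> i = j + 1)}\<rparr>"

definition labeled_semi_Hamiltonian :: "nat \<Rightarrow> nat pair_pre_digraph \<Rightarrow> bool" where
  "labeled_semi_Hamiltonian n G \<longleftrightarrow>
     pair_graph G \<and> pverts G = {1..n} \<and>
     subgraph (with_proj (path_graph n)) (with_proj G) \<and> (1, n) \<notin> parcs G"

definition hankel_binomial :: "nat \<Rightarrow> nat \<Rightarrow> 'k::field mpoly" where
  "hankel_binomial i j = X i * X (j + 1) - X j * X (i + 1)"

definition hankel_edge_ideal :: "nat \<Rightarrow> nat pair_pre_digraph \<Rightarrow> 'k::field mpoly set" where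
  "hankel_edge_ideal n G =
     genideal (poly_ring n) {hankel_binomial i j | i j. i < j \<and> (i, j) \<in> parcs G}"

end

theory Submission
  imports Defs
begin

text \<open>
  The number of generators of \<open>I\<^sub>G\<close> is the number of edges, because the \<open>g\<^sub>i\<^sub>j\<close> are linearly
  independent quadrics. The height of \<open>I\<^sub>G\<close> is at most \<open>n - 1\<close>: as \<open>{1, n}\<close> is not an edge, \<open>I\<^sub>G\<close> lies in
  the prime \<open>(x\<^sub>2, \<dots>, x\<^sub>n)\<close>, and a chain ending there extends by two further primes, while
  \<open>\<bbbK>[x\<^sub>1, \<dots>, x\<^sub>n\<^sub>+\<^sub>1]\<close> has dimension \<open>n + 1\<close>. So one edge beyond the path is already too many. For
  the path itself, a prime containing \<open>x\<^sub>i x\<^sub>i\<^sub>+\<^sub>2 - x\<^sub>i\<^sub>+\<^sub>1\<^sup>2\<close> for all \<open>i\<close> either contains \<open>x\<^sub>2, \<dots>, x\<^sub>n\<close> or avoids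
  every variable and then contains the ideal of the rational normal curve; below each of the two
  ideals there is a chain of \<open>n - 1\<close> steps, consisting of kernels of substitutions.
\<close>

section \<open>Substitution homomorphisms\<close>

abbreviation "keys \<equiv> Poly_Mapping.keys"
abbreviation "lookup \<equiv> Poly_Mapping.lookup"
abbreviation "single \<equiv> Poly_Mapping.single"

text \<open>Scalars act by multiplication with \<open>cst c\<close>, so that linear algebra over the
  field takes place inside the ring itself.\<close>

definition cst :: "'k::field \<Rightarrow> 'k mpoly" where
  "cst c = single 0 c"

lemma cst_0 [simp]: "cst 0 = 0"
  and cst_1 [simp]: "cst 1 = 1"
  and cst_add: "cst (a + b) = cst a + cst b"
  and cst_mult: "cst (a * b) = cst a * cst b"
  by (simp_all add: cst_def single_add mult_single)

lemma cst_mult_single [simp]: "cst a * single m b = single m (a * b)"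
  by (simp add: cst_def mult_single)

lemma lookup_cst_mult [simp]: "lookup (cst c * p) m = c * lookup p m"
  unfolding cst_def mult_map_scale_conv_mult[symmetric]
  by (simp add: Poly_Mapping.map.rep_eq when_def)

lemma vector_space_cst: "vector_space (\<lambda>c p. cst c * p :: 'k::field mpoly)"
  by standard (simp_all add: algebra_simps cst_add cst_mult)

lemma mpoly_eq_sum_single: "(p :: 'a \<Rightarrow>\<^sub>0 'b::comm_monoid_add) = (\<Sum>m\<in>keys p. single m (lookup p m))"
proof (rule poly_mapping_eqI)
  fix k show "lookup p k = lookup (\<Sum>m\<in>keys p. single m (lookup p m)) k"
    by (simp add: lookup_sum lookup_single when_def in_keys_iff)
qed

lemma mpoly_induct [case_names zero single add]:
  fixes p :: "'a \<Rightarrow>\<^sub>0 'b::comm_monoid_add"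
  assumes "P 0" "\<And>m c. P (single m c)" "\<And>p q. P p \<Longrightarrow> P q \<Longrightarrow> P (p + q)"
  shows "P p"
proof -
  have "P (\<Sum>m\<in>S. single m (lookup p m))" if "finite S" for S
    using that by induction (auto intro: assms)
  then show ?thesis
    by (subst mpoly_eq_sum_single) simp
qed

text \<open>Linear extension of a map given on the monomials. Substitutions, relabellings of
  monomials and the quadratic part are all of this form.\<close>

definition lin :: "('a \<Rightarrow> 'k::field mpoly) \<Rightarrow> ('a \<Rightarrow>\<^sub>0 'k) \<Rightarrow> 'k mpoly" where
  "lin g p = (\<Sum>m\<in>keys p. cst (lookup p m) * g m)"

lemma lin_superset: "finite S \<Longrightarrow> keys p \<subseteq> S \<Longrightarrow> lin g p = (\<Sum>m\<in>S. cst (lookup p m) * g m)"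
  unfolding lin_def by (intro sum.mono_neutral_left) (auto simp: in_keys_iff)

lemma lin_0 [simp]: "lin g 0 = 0"
  by (simp add: lin_def)

lemma lin_single [simp]: "lin g (single m c) = cst c * g m"
  by (simp add: lin_superset[of "{m}"])

lemma lin_add: "lin g (p + q) = lin g p + lin g q"
  using keys_add[of p q]
  by (simp add: lin_superset[of "keys p \<union> keys q"] lookup_add cst_add algebra_simps sum.distrib)

lemma lin_cst_mult: "lin g (cst c * p) = cst c * lin g p"
  by (induction p rule: mpoly_induct) (simp_all add: lin_add algebra_simps cst_mult)

text \<open>\<open>A\<close> may merge monomials: if the relabelled polynomial cancels to zero, then
  so does every linear image that sees a monomial only through \<open>A\<close>.\<close>

lemma lin_lin_single: "lin g (lin (\<lambda>m. single (A m) 1) p) = lin (\<lambda>m. g (A m)) p"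
  by (induction p rule: mpoly_induct) (simp_all add: lin_add lin_cst_mult)

lemma lin_monomials: "lin (\<lambda>m. single m 1) p = p"
  by (induction p rule: mpoly_induct) (simp_all add: lin_add)

definition monom_eval :: "(nat \<Rightarrow> 'k::field mpoly) \<Rightarrow> (nat \<Rightarrow>\<^sub>0 nat) \<Rightarrow> 'k mpoly" where
  "monom_eval \<sigma> m = (\<Prod>i\<in>keys m. \<sigma> i ^ lookup m i)"

lemma monom_eval_superset:
  "finite S \<Longrightarrow> keys m \<subseteq> S \<Longrightarrow> monom_eval \<sigma> m = (\<Prod>i\<in>S. \<sigma> i ^ lookup m i)"
  unfolding monom_eval_def by (intro prod.mono_neutral_left) (auto simp: in_keys_iff)

lemma monom_eval_0 [simp]: "monom_eval \<sigma> 0 = 1"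
  by (simp add: monom_eval_def)

lemma monom_eval_single [simp]: "monom_eval \<sigma> (single i k) = \<sigma> i ^ k"
  by (simp add: monom_eval_superset[of "{i}"])

lemma monom_eval_add: "monom_eval \<sigma> (a + b) = monom_eval \<sigma> a * monom_eval \<sigma> b"
  using keys_add[of a b]
  by (simp add: monom_eval_superset[of "keys a \<union> keys b"] lookup_add power_add prod.distrib)

lemma monom_eval_X: "monom_eval X m = (single m 1 :: 'k::field mpoly)"
proof (induction m rule: mpoly_induct)
  case (single i k)
  have "X i ^ k = (single (single i k) 1 :: 'k mpoly)"
    by (induction k) (simp_all add: X_def mult_single flip: single_add)
  then show ?case by simp
qed (simp_all add: monom_eval_add mult_single)

definition subst :: "(nat \<Rightarrow> 'k::field mpoly) \<Rightarrow> 'k mpoly \<Rightarrow> 'k mpoly" where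
  "subst \<sigma> = lin (monom_eval \<sigma>)"

lemma subst_0 [simp]: "subst \<sigma> 0 = 0"
  and subst_add: "subst \<sigma> (p + q) = subst \<sigma> p + subst \<sigma> q"
  and subst_single: "subst \<sigma> (single m c) = cst c * monom_eval \<sigma> m"
  and subst_cst_mult: "subst \<sigma> (cst c * p) = cst c * subst \<sigma> p"
  by (simp_all add: subst_def lin_add lin_cst_mult)

lemma subst_1 [simp]: "subst \<sigma> 1 = 1"
  using subst_single[of \<sigma> 0 1] by simp

lemma subst_X [simp]: "subst \<sigma> (X i) = \<sigma> i"
  by (simp add: X_def subst_single)

lemma subst_mult: "subst \<sigma> (p * q) = subst \<sigma> p * subst \<sigma> q"
proof (induction p rule: mpoly_induct)
  case (single m c)
  show ?case
    by (induction q rule: mpoly_induct)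
       (simp_all add: subst_add algebra_simps mult_single subst_single monom_eval_add cst_mult)
qed (simp_all add: subst_add algebra_simps)

lemma subst_uminus: "subst \<sigma> (- p) = - subst \<sigma> p"
  using subst_add[of \<sigma> p "- p"] by (simp add: eq_neg_iff_add_eq_0 add.commute)

lemma subst_diff: "subst \<sigma> (p - q) = subst \<sigma> p - subst \<sigma> q"
  using subst_add[of \<sigma> p "- q"] by (simp add: subst_uminus)

lemma subst_power: "subst \<sigma> (p ^ k) = subst \<sigma> p ^ k"
  by (induction k) (simp_all add: subst_mult)

lemma subst_monom_eval: "subst \<tau> (monom_eval \<sigma> m) = monom_eval (\<lambda>i. subst \<tau> (\<sigma> i)) m"
  by (induction m rule: mpoly_induct) (simp_all add: monom_eval_add subst_mult subst_power)

lemma subst_subst: "subst \<tau> (subst \<sigma> p) = subst (\<lambda>i. subst \<tau> (\<sigma> i)) p"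
  by (induction p rule: mpoly_induct)
     (simp_all add: subst_add subst_single subst_cst_mult subst_monom_eval)

section \<open>Prime ideals of the polynomial ring\<close>

lemma poly_ring_simps [simp]:
  "carrier (poly_ring n) = poly_carrier n" "monoid.mult (poly_ring n) = (*)"
  "one (poly_ring n) = 1" "zero (poly_ring n) = 0" "add (poly_ring n) = (+)"
  by (simp_all add: poly_ring_def)

lemma ring_poly_ring: "ring (poly_ring n :: 'k::field mpoly ring)"
  using cring_poly_ring cring.axioms(1) by blast

lemma poly_carrier_0 [simp]: "0 \<in> poly_carrier n"
  and poly_carrier_1 [simp]: "1 \<in> poly_carrier n"
  and poly_carrier_cst [simp]: "cst c \<in> poly_carrier n"
  and poly_carrier_X [simp]: "X i \<in> poly_carrier n \<longleftrightarrow> 1 \<le> i \<and> i \<le> n + 1"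
  and poly_carrier_uminus: "p \<in> poly_carrier n \<Longrightarrow> - p \<in> poly_carrier n"
  by (auto simp: poly_carrier_def cst_def X_def)

lemma poly_carrier_diff: "p \<in> poly_carrier n \<Longrightarrow> q \<in> poly_carrier n \<Longrightarrow> p - q \<in> poly_carrier n"
  using poly_carrier_add[of p n "- q"] by (simp add: poly_carrier_uminus)

lemma poly_carrier_power: "p \<in> poly_carrier n \<Longrightarrow> p ^ k \<in> poly_carrier n"
  by (induction k) (simp_all add: poly_carrier_mult)

lemma poly_carrier_sum: "(\<And>i. i \<in> S \<Longrightarrow> f i \<in> poly_carrier n) \<Longrightarrow> sum f S \<in> poly_carrier n"
  by (induction S rule: infinite_finite_induct) (simp_all add: poly_carrier_add)

lemma poly_carrier_prod: "(\<And>i. i \<in> S \<Longrightarrow> f i \<in> poly_carrier n) \<Longrightarrow> prod f S \<in> poly_carrier n"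
  by (induction S rule: infinite_finite_induct) (simp_all add: poly_carrier_mult)

lemma ideal_poly_ringI:
  fixes I :: "'k::field mpoly set"
  assumes "I \<subseteq> poly_carrier n" "0 \<in> I" "\<And>a b. a \<in> I \<Longrightarrow> b \<in> I \<Longrightarrow> a + b \<in> I"
    and "\<And>a r. a \<in> I \<Longrightarrow> r \<in> poly_carrier n \<Longrightarrow> r * a \<in> I"
  shows "ideal I (poly_ring n)"
proof (rule idealI[OF ring_poly_ring])
  interpret R: ring "poly_ring n :: 'k mpoly ring" by (rule ring_poly_ring)
  have uminus: "\<ominus>\<^bsub>poly_ring n\<^esub> a = - a" if "a \<in> poly_carrier n" for a :: "'k mpoly"
    using that by (intro R.minus_equality) (auto simp: poly_carrier_uminus)
  have "- a \<in> I" if "a \<in> I" for a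
    using assms(4)[of a "- 1"] that by (simp add: poly_carrier_uminus)
  then show "subgroup I (add_monoid (poly_ring n))"
    using assms by (intro R.add.subgroupI) (auto simp: uminus subset_iff simp flip: a_inv_def)
qed (use assms in \<open>auto simp: mult.commute\<close>)

lemma ideal_poly_ringD:
  fixes I :: "'k::field mpoly set"
  assumes "ideal I (poly_ring n)"
  shows "I \<subseteq> poly_carrier n" "0 \<in> I" "a \<in> I \<Longrightarrow> b \<in> I \<Longrightarrow> a + b \<in> I"
    and "a \<in> I \<Longrightarrow> r \<in> poly_carrier n \<Longrightarrow> r * a \<in> I"
    and "a \<in> I \<Longrightarrow> b \<in> I \<Longrightarrow> a - b \<in> I"
proof -
  interpret ideal I "poly_ring n" by fact
  show sub: "I \<subseteq> poly_carrier n" using a_subset by simp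
  show "0 \<in> I" using additive_subgroup.zero_closed[OF additive_subgroup_axioms] by simp
  show add: "a \<in> I \<Longrightarrow> b \<in> I \<Longrightarrow> a + b \<in> I" for a b
    using additive_subgroup.a_closed[OF additive_subgroup_axioms] by simp
  show mult: "a \<in> I \<Longrightarrow> r \<in> poly_carrier n \<Longrightarrow> r * a \<in> I" for a r using I_l_closed[of a r] by simp
  show "a \<in> I \<Longrightarrow> b \<in> I \<Longrightarrow> a - b \<in> I"
    using add[of a "- b"] mult[of b "- 1"] by (simp add: poly_carrier_uminus)
qed

lemma ideal_poly_ring_sum:
  assumes "ideal I (poly_ring n)" "\<And>i. i \<in> S \<Longrightarrow> f i \<in> I"
  shows "sum f S \<in> I"
  using assms(2)
  by (induction S rule: infinite_finite_induct) (simp_all add: ideal_poly_ringD[OF assms(1)])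

lemma primeideal_poly_ringD:
  fixes P :: "'k::field mpoly set"
  assumes "primeideal P (poly_ring n)"
  shows "ideal P (poly_ring n)" "1 \<notin> P"
    and "a \<in> poly_carrier n \<Longrightarrow> b \<in> poly_carrier n \<Longrightarrow> a * b \<in> P \<Longrightarrow> a \<in> P \<or> b \<in> P"
proof -
  interpret primeideal P "poly_ring n" by fact
  show "ideal P (poly_ring n)" ..
  show "1 \<notin> P" using one_imp_carrier I_notcarr by auto
  show "a \<in> poly_carrier n \<Longrightarrow> b \<in> poly_carrier n \<Longrightarrow> a * b \<in> P \<Longrightarrow> a \<in> P \<or> b \<in> P"
    using I_prime[of a b] by simp
qed

lemma primeideal_power:
  assumes "primeideal P (poly_ring n)" "a \<in> poly_carrier n" "a ^ k \<in> P"
  shows "a \<in> P"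
  using assms(3)
proof (induction k)
  case (Suc k)
  then show ?case
    using primeideal_poly_ringD(3)[OF assms(1,2), of "a ^ k"] assms(2) poly_carrier_power by auto
qed (use primeideal_poly_ringD(2)[OF assms(1)] in simp)

definition subst_kernel :: "nat \<Rightarrow> (nat \<Rightarrow> 'k::field mpoly) \<Rightarrow> 'k mpoly set" where
  "subst_kernel n \<sigma> = {p \<in> poly_carrier n. subst \<sigma> p = 0}"

text \<open>The target has no zero divisors and \<open>1\<close> is mapped to \<open>1\<close>, so
  the kernel is proper and prime.\<close>

lemma primeideal_subst_kernel: "primeideal (subst_kernel n \<sigma>) (poly_ring n)"
proof (rule primeidealI)
  show "ideal (subst_kernel n \<sigma>) (poly_ring n)"
    by (rule ideal_poly_ringI)
       (auto simp: subst_kernel_def subst_add subst_mult poly_carrier_add poly_carrier_mult)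
  have "1 \<in> poly_carrier n" "1 \<notin> subst_kernel n \<sigma>"
    by (simp_all add: subst_kernel_def)
  then show "carrier (poly_ring n) \<noteq> subst_kernel n \<sigma>" by auto
qed (auto simp: cring_poly_ring subst_kernel_def subst_mult)

text \<open>Following a substitution by another one can only enlarge the kernel, and
  \<open>p\<close> witnesses strictness. All explicit chains of primes below arise in this
  way.\<close>

lemma subst_kernel_psubset:
  assumes "\<And>i. \<tau> i = subst \<rho> (\<sigma> i)" "p \<in> poly_carrier n" "subst \<tau> p = 0" "subst \<sigma> p \<noteq> 0"
  shows "subst_kernel n \<sigma> \<subset> subst_kernel n \<tau>"
proof -
  have "\<tau> = (\<lambda>i. subst \<rho> (\<sigma> i))" using assms(1) by auto
  then have "subst \<tau> q = subst \<rho> (subst \<sigma> q)" for q by (simp add: subst_subst)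
  then show ?thesis using assms(2-4) by (auto simp: subst_kernel_def)
qed

section \<open>Dimension of the polynomial ring\<close>

text \<open>Each exponent is bounded separately, rather than the total degree: the number of
  monomials is then bounded by a power, and the bounds add under multiplication.\<close>

definition exponent_box :: "nat \<Rightarrow> nat \<Rightarrow> (nat \<Rightarrow>\<^sub>0 nat) set" where
  "exponent_box n e = {m. keys m \<subseteq> {1..n + 1} \<and> (\<forall>i. lookup m i \<le> e)}"

lemma exponent_box_bounded:
  shows "finite (exponent_box n e)" and "card (exponent_box n e) \<le> (e + 1) ^ (n + 1)"
proof -
  let ?r = "\<lambda>m :: nat \<Rightarrow>\<^sub>0 nat. restrict (lookup m) {1..n + 1}"
  let ?F = "{1..n + 1} \<rightarrow>\<^sub>E {..e}"
  have inj: "inj_on ?r (exponent_box n e)"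
  proof (rule inj_onI)
    fix m m' assume mm: "m \<in> exponent_box n e" "m' \<in> exponent_box n e" "?r m = ?r m'"
    have "lookup m i = lookup m' i" for i
    proof (cases "i \<in> {1..n + 1}")
      case True
      then show ?thesis using fun_cong[OF mm(3), of i] by simp
    next
      case False
      then have "i \<notin> keys m" "i \<notin> keys m'" using mm(1,2) by (auto simp: exponent_box_def)
      then show ?thesis by (simp add: in_keys_iff)
    qed
    then show "m = m'" by (intro poly_mapping_eqI)
  qed
  have sub: "?r ` exponent_box n e \<subseteq> ?F"
    by (auto simp: exponent_box_def)
  have fin: "finite ?F" by (simp add: finite_PiE)
  show "finite (exponent_box n e)" using inj_on_finite[OF inj sub fin] .
  show "card (exponent_box n e) \<le> (e + 1) ^ (n + 1)"
    using card_inj_on_le[OF inj sub fin] by (simp add: card_PiE)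
qed

lemma keys_mult_exponent_box:
  assumes "keys p \<subseteq> exponent_box n d" "keys q \<subseteq> exponent_box n e"
  shows "keys (p * q) \<subseteq> exponent_box n (d + e)"
proof
  fix m assume "m \<in> keys (p * q)"
  then obtain a b where ab: "a \<in> keys p" "b \<in> keys q" "m = a + b"
    using keys_mult[of p q] by blast
  then have "a \<in> exponent_box n d" "b \<in> exponent_box n e" using assms by auto
  then show "m \<in> exponent_box n (d + e)"
    using ab(3) keys_add[of a b] by (auto simp: exponent_box_def lookup_add intro: add_mono)
qed

lemma keys_power_exponent_box:
  assumes "keys p \<subseteq> exponent_box n d"
  shows "keys (p ^ k :: 'k::field mpoly) \<subseteq> exponent_box n (k * d)"
proof (induction k)
  case (Suc k)
  then show ?case using keys_mult_exponent_box[OF assms Suc] by simp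
qed (auto simp: exponent_box_def)

lemma keys_prod_exponent_box:
  assumes "\<And>i. i \<in> S \<Longrightarrow> keys (f i :: 'k::field mpoly) \<subseteq> exponent_box n (e i)"
  shows "keys (prod f S) \<subseteq> exponent_box n (sum e S)"
  using assms
proof (induction S rule: infinite_finite_induct)
  case (insert i S)
  then show ?case using keys_mult_exponent_box[of "f i" n "e i" "prod f S" "sum e S"] by simp
qed (auto simp: exponent_box_def)

lemma exponent_box_mono: "d \<le> e \<Longrightarrow> exponent_box n d \<subseteq> exponent_box n e"
  by (auto simp: exponent_box_def intro: order_trans)

lemma obtain_exponent_box:
  fixes a :: "nat \<Rightarrow> 'k::field mpoly"
  assumes "\<And>i. i \<le> N \<Longrightarrow> a i \<in> poly_carrier n"
  obtains d where "\<And>i. i \<le> N \<Longrightarrow> keys (a i) \<subseteq> exponent_box n d"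
proof -
  let ?S = "\<Union>i\<in>{..N}. \<Union>m\<in>keys (a i). lookup m ` {1..n + 1}"
  have "finite ?S" by simp
  then have "\<exists>d. \<forall>x\<in>?S. x \<le> d" unfolding finite_nat_set_iff_bounded_le .
  then obtain d where d: "\<forall>x\<in>?S. x \<le> d" ..
  show ?thesis
  proof (rule that)
    fix i assume i: "i \<le> N"
    show "keys (a i) \<subseteq> exponent_box n d"
    proof
      fix m assume m: "m \<in> keys (a i)"
      then have k: "keys m \<subseteq> {1..n + 1}" using assms[OF i] by (simp add: poly_carrier_def)
      have "lookup m j \<le> d" for j
      proof (cases "j \<in> {1..n + 1}")
        case True
        then have "lookup m j \<in> ?S" using i m by blast
        then show ?thesis using d by blast
      next
        case False
        then have "j \<notin> keys m" using k by blast
        then show ?thesis by (simp add: in_keys_iff)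
      qed
      then show "m \<in> exponent_box n d" using k by (simp add: exponent_box_def)
    qed
  qed
qed

text \<open>
  There are \<open>D\<^bsup>n+2\<^esup>\<close> products of powers with exponents below \<open>D\<close>, and they lie in a space whose
  dimension grows only like \<open>D\<^bsup>n+1\<^esup>\<close>.
\<close>

lemma algebraic_dependence:
  fixes a :: "nat \<Rightarrow> 'k::field mpoly"
  assumes a: "\<forall>i\<le>n + 1. a i \<in> poly_carrier n"
  shows "\<exists>(E :: (nat \<Rightarrow> nat) set) c. finite E \<and> E \<noteq> {} \<and> E \<subseteq> extensional {..n + 1} \<and>
    (\<forall>m\<in>E. c m \<noteq> 0) \<and> (\<Sum>m\<in>E. cst (c m) * (\<Prod>i\<le>n + 1. a i ^ m i)) = 0"
proof -
  interpret V: vector_space "\<lambda>c p. cst c * p :: 'k mpoly" by (rule vector_space_cst)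
  obtain d where d: "\<And>i. i \<le> n + 1 \<Longrightarrow> keys (a i) \<subseteq> exponent_box n d"
    using obtain_exponent_box[of "n + 1" a n] a by blast
  \<comment> \<open>With these choices \<open>e + 1 \<le> K * D\<close> and
    \<open>K ^ (n + 1) < D\<close>, so the at most \<open>(e + 1) ^ (n + 1)\<close> monomials are
    fewer than the \<open>D ^ (n + 2)\<close> exponent functions.\<close>
  define K where "K = (n + 2) * d + 1"
  define D where "D = K ^ (n + 1) + 1"
  define F where "F = ({..n + 1} \<rightarrow>\<^sub>E {..<D})"
  define f where "f m = (\<Prod>i\<le>n + 1. a i ^ m i)" for m
  define e where "e = (n + 2) * D * d"
  define T where "T = (\<lambda>m. single m (1::'k)) ` exponent_box n e"
  have finF: "finite F" by (simp add: F_def finite_PiE)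
  have cardF: "card F = D ^ (n + 2)" by (simp add: F_def card_PiE)
  \<comment> \<open>Extensionality makes exponent functions that agree on \<open>{..n + 1}\<close>
    equal; the chain argument needs this to isolate a single term.\<close>
  have extF: "F \<subseteq> extensional {..n + 1}" by (auto simp: F_def PiE_def)
  have finT: "finite T" by (simp add: T_def exponent_box_bounded)
  have "e + 1 \<le> K * D" unfolding e_def K_def D_def by (simp add: algebra_simps)
  then have "(e + 1) ^ (n + 1) \<le> K ^ (n + 1) * D ^ (n + 1)"
    by (metis power_mono power_mult_distrib zero_le)
  also have "\<dots> < D * D ^ (n + 1)" by (simp add: D_def)
  finally have "(e + 1) ^ (n + 1) < card F" by (simp add: cardF)
  moreover have "card T \<le> (e + 1) ^ (n + 1)"
    using card_image_le[OF exponent_box_bounded(1)[of n e]] exponent_box_bounded(2)[of n e]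
    unfolding T_def by (rule order_trans)
  ultimately have TF: "card T < card F" by simp
  have span: "f m \<in> V.span T" if "m \<in> F" for m
  proof -
    have "keys (f m) \<subseteq> exponent_box n (\<Sum>i\<le>n + 1. m i * d)"
      unfolding f_def using d by (intro keys_prod_exponent_box keys_power_exponent_box) simp
    moreover have "(\<Sum>i\<le>n + 1. m i * d) \<le> (\<Sum>i\<le>n + 1. D * d)"
      using that by (intro sum_mono mult_right_mono) (auto simp: F_def PiE_iff less_imp_le)
    moreover have "(\<Sum>i\<le>n + 1. D * d) = e" by (simp add: e_def algebra_simps)
    ultimately have k: "keys (f m) \<subseteq> exponent_box n e"
      using exponent_box_mono[of "\<Sum>i\<le>n + 1. m i * d" e n] by (metis order_trans)
    have "(\<Sum>x\<in>keys (f m). cst (lookup (f m) x) * single x 1) \<in> V.span T"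
      using k by (intro V.span_sum V.span_scale V.span_base) (auto simp: T_def)
    then show ?thesis using lin_monomials[of "f m"] by (simp add: lin_def del: cst_mult_single)
  qed
  have "\<exists>c. (\<exists>m\<in>F. c m \<noteq> 0) \<and> (\<Sum>m\<in>F. cst (c m) * f m) = 0"
  proof (cases "inj_on f F")
    case True
    have "V.dependent (f ` F)"
    proof (rule ccontr)
      assume "\<not> V.dependent (f ` F)"
      then have "card (f ` F) \<le> card T"
        using V.independent_span_bound[OF finT] span by auto
      then show False using TF card_image[OF True] by simp
    qed
    then obtain u where u: "\<exists>v\<in>f ` F. u v \<noteq> 0" "(\<Sum>v\<in>f ` F. cst (u v) * v) = 0"
      using V.dependent_finite[of "f ` F"] finF by auto
    then show ?thesis by (intro exI[of _ "u \<circ> f"]) (auto simp: sum.reindex[OF True])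
  next
    case False
    then obtain m m' where mm: "m \<in> F" "m' \<in> F" "m \<noteq> m'" "f m = f m'"
      by (auto simp: inj_on_def)
    let ?c = "\<lambda>x. if x = m then 1 else if x = m' then - 1 else (0::'k)"
    have "(\<Sum>x\<in>F. cst (?c x) * f x) = (\<Sum>x\<in>{m, m'}. cst (?c x) * f x)"
      using mm finF by (intro sum.mono_neutral_right) auto
    also have "\<dots> = (cst 1 + cst (- 1)) * f m'" using mm by (simp add: algebra_simps)
    also have "\<dots> = 0" unfolding cst_add[symmetric] by simp
    finally show ?thesis using mm by (intro exI[of _ ?c]) auto
  qed
  then obtain c where c: "\<exists>m\<in>F. c m \<noteq> 0" "(\<Sum>m\<in>F. cst (c m) * f m) = 0" by blast
  show ?thesis
  proof (intro exI[of _ "{m\<in>F. c m \<noteq> 0}"] exI[of _ c] conjI)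
    have "(\<Sum>m | m \<in> F \<and> c m \<noteq> 0. cst (c m) * f m) = (\<Sum>m\<in>F. cst (c m) * f m)"
      using finF by (intro sum.mono_neutral_left) auto
    then show "(\<Sum>m | m \<in> F \<and> c m \<noteq> 0. cst (c m) * (\<Prod>i\<le>n + 1. a i ^ m i)) = 0"
      using c(2) by (simp add: f_def)
  qed (use finF extF c(1) in auto)
qed

text \<open>
  Coquand and Lombardi: choose \<open>a\<^sub>i \<in> C\<^sub>i\<^sub>+\<^sub>1 - C\<^sub>i\<close>. An algebraic relation between the \<open>a\<^sub>i\<close> lies in
  \<open>C\<^sub>0\<close>; going up the chain, one divides by the lowest power of \<open>a\<^sub>j\<close>, which is not in \<open>C\<^sub>j\<close>, and
  discards the terms still divisible by \<open>a\<^sub>j\<close>, which are in \<open>C\<^sub>j\<^sub>+\<^sub>1\<close>. In the end a nonzero constant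
  remains.
\<close>

lemma prime_chain_length_le:
  fixes C :: "nat \<Rightarrow> 'k::field mpoly set"
  assumes prime: "\<And>i. i \<le> k \<Longrightarrow> primeideal (C i) (poly_ring n)"
    and chain: "\<And>i. i < k \<Longrightarrow> C i \<subset> C (Suc i)"
  shows "k \<le> n + 1"
proof (rule ccontr)
  assume "\<not> k \<le> n + 1"
  then have k: "n + 2 \<le> k" by simp
  have "\<forall>i. \<exists>x. i < k \<longrightarrow> x \<in> C (Suc i) - C i" using chain by blast
  then obtain a where a: "\<And>i. i < k \<Longrightarrow> a i \<in> C (Suc i) - C i" by metis
  have carr: "a i \<in> poly_carrier n" if "i < k" for i
    using a[OF that] ideal_poly_ringD(1)[OF primeideal_poly_ringD(1)[OF prime[of "Suc i"]]] that
    by auto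
  have "\<forall>i\<le>n + 1. a i \<in> poly_carrier n" using carr k by simp
  from algebraic_dependence[OF this]
  obtain E :: "(nat \<Rightarrow> nat) set" and c where E: "finite E" "E \<noteq> {}"
    "E \<subseteq> extensional {..n + 1}" "\<forall>m\<in>E. c m \<noteq> 0"
    "(\<Sum>m\<in>E. cst (c m) * (\<Prod>i\<le>n + 1. a i ^ m i)) = 0"
    by (elim exE conjE)
  \<comment> \<open>Induction up the chain. \<open>T\<close> holds the surviving terms, whose
    exponents below \<open>j\<close> agree; after \<open>n + 2\<close> rounds all exponents agree
    and one term is left.\<close>
  have "\<exists>T\<subseteq>E. T \<noteq> {} \<and> (\<forall>m\<in>T. \<forall>m'\<in>T. \<forall>i<j. m i = m' i) \<and>
      (\<Sum>m\<in>T. cst (c m) * (\<Prod>i=j..n + 1. a i ^ m i)) \<in> C j" if "j \<le> n + 2" for j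
    using that
  proof (induction j)
    case 0
    then show ?case
      using E(2,5) ideal_poly_ringD(2)[OF primeideal_poly_ringD(1)[OF prime[of 0]]]
      by (intro exI[of _ E]) (simp add: atMost_atLeast0)
  next
    case (Suc j)
    then have j: "j \<le> n + 1" "j < k" "j \<le> k" "Suc j \<le> k" using k by simp_all
    from Suc obtain T where T: "T \<subseteq> E" "T \<noteq> {}" "\<forall>m\<in>T. \<forall>m'\<in>T. \<forall>i<j. m i = m' i"
      "(\<Sum>m\<in>T. cst (c m) * (\<Prod>i=j..n + 1. a i ^ m i)) \<in> C j" by auto
    have finT: "finite T" using T(1) E(1) finite_subset by blast
    \<comment> \<open>The lowest power of \<open>a j\<close> factors out of all surviving terms. As
      \<open>C j\<close> is prime and misses \<open>a j\<close>, the cofactor stays in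
      \<open>C j\<close>.\<close>
    define e where "e = Min ((\<lambda>m. m j) ` T)"
    have e_le: "e \<le> m j" if "m \<in> T" for m using that finT by (simp add: e_def)
    have "e \<in> (\<lambda>m. m j) ` T" unfolding e_def using finT T(2) by (intro Min_in) auto
    then obtain m0 where m0: "m0 \<in> T" "m0 j = e" by auto
    define T' where "T' = {m \<in> T. m j = e}"
    define r where "r m = (\<Prod>i=Suc j..n + 1. a i ^ m i)" for m
    have r: "r m \<in> poly_carrier n" for m
      unfolding r_def using carr k by (intro poly_carrier_prod poly_carrier_power) auto
    define g where "g m = cst (c m) * (a j ^ (m j - e) * r m)" for m
    note I = primeideal_poly_ringD(1)[OF prime[OF j(3)]]
    note I' = primeideal_poly_ringD(1)[OF prime[OF j(4)]]
    have g: "g m \<in> poly_carrier n" for m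
      unfolding g_def by (intro poly_carrier_mult poly_carrier_power carr j r poly_carrier_cst)
    have "(\<Sum>m\<in>T. cst (c m) * (\<Prod>i=j..n + 1. a i ^ m i)) = a j ^ e * sum g T"
      unfolding sum_distrib_left
    proof (rule sum.cong)
      fix m assume "m \<in> T"
      have "(\<Prod>i=j..n + 1. a i ^ m i) = a j ^ m j * r m"
        unfolding r_def using j(1) by (rule prod.atLeast_Suc_atMost)
      also have "a j ^ m j = a j ^ e * a j ^ (m j - e)"
        using e_le[OF \<open>m \<in> T\<close>] by (simp flip: power_add)
      finally show "cst (c m) * (\<Prod>i=j..n + 1. a i ^ m i) = a j ^ e * g m"
        by (simp add: g_def ac_simps)
    qed simp
    then have "a j ^ e * sum g T \<in> C j" using T(4) by simp
    moreover have "a j ^ e \<notin> C j"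
      using primeideal_power[OF prime[OF j(3)] carr[OF j(2)]] a[OF j(2)] by blast
    ultimately have "sum g T \<in> C j"
      using primeideal_poly_ringD(3)[OF prime[OF j(3)], of "a j ^ e" "sum g T"]
        poly_carrier_power[OF carr[OF j(2)]] poly_carrier_sum[of T g n] g by blast
    then have gT: "sum g T \<in> C (Suc j)" using chain[OF j(2)] by blast
    have "g m \<in> C (Suc j)" if "m \<in> T - T'" for m
    proof -
      have "m j - e \<noteq> 0" using that e_le[of m] by (auto simp: T'_def)
      then have "g m = (cst (c m) * (a j ^ (m j - e - 1) * r m)) * a j"
        by (cases "m j - e") (simp_all add: g_def ac_simps)
      moreover have "cst (c m) * (a j ^ (m j - e - 1) * r m) \<in> poly_carrier n"
        by (intro poly_carrier_mult poly_carrier_power carr j r poly_carrier_cst)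
      ultimately show ?thesis
        using ideal_poly_ringD(4)[OF I', of "a j"] a[OF j(2)] by simp
    qed
    then have "sum g (T - T') \<in> C (Suc j)" by (rule ideal_poly_ring_sum[OF I'])
    moreover have "sum g T = sum g (T - T') + sum g T'"
      using finT by (intro sum.subset_diff) (auto simp: T'_def)
    ultimately have "sum g T' \<in> C (Suc j)"
      using ideal_poly_ringD(5)[OF I' gT, of "sum g (T - T')"] by simp
    moreover have "sum g T' = (\<Sum>m\<in>T'. cst (c m) * r m)"
      by (intro sum.cong) (simp_all add: g_def T'_def)
    ultimately have "(\<Sum>m\<in>T'. cst (c m) * r m) \<in> C (Suc j)" by simp
    moreover have "T' \<subseteq> E" "T' \<noteq> {}" using T(1) m0 by (auto simp: T'_def)
    moreover have "\<forall>m\<in>T'. \<forall>m'\<in>T'. \<forall>i<Suc j. m i = m' i"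
      using T(3) by (auto simp: T'_def less_Suc_eq)
    ultimately show ?case unfolding r_def by blast
  qed
  from this[of "n + 2"] obtain T where T: "T \<subseteq> E" "T \<noteq> {}"
    "\<forall>m\<in>T. \<forall>m'\<in>T. \<forall>i<n + 2. m i = m' i"
    "(\<Sum>m\<in>T. cst (c m) * (\<Prod>i=n + 2..n + 1. a i ^ m i)) \<in> C (n + 2)" by auto
  obtain m where m: "m \<in> T" using T(2) by blast
  have "m' = m" if "m' \<in> T" for m'
    using T(1,3) E(3) m that by (intro extensionalityI[of m' "{..n + 1}" m]) auto
  then have "T = {m}" using m by blast
  \<comment> \<open>The product over \<open>{n + 2..n + 1}\<close> is empty, so only the coefficient
    remains; being nonzero, it is a unit and lies in no prime.\<close>
  then have "cst (c m) \<in> C (n + 2)" using T(4) by simp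
  moreover note P = prime[OF k]
  ultimately have "cst (inverse (c m)) * cst (c m) \<in> C (n + 2)"
    using ideal_poly_ringD(4)[OF primeideal_poly_ringD(1)[OF P]] by simp
  moreover have "cst (inverse (c m)) * cst (c m) = 1"
    using E(4) T(1) m by (auto simp flip: cst_mult)
  ultimately show False using primeideal_poly_ringD(2)[OF P] by simp
qed

section \<open>Heights\<close>

lemma prime_height_le:
  assumes "\<And>k C. (\<And>i. i \<le> k \<Longrightarrow> primeideal (C i) R) \<Longrightarrow> (\<And>i. i < k \<Longrightarrow> C i \<subset> C (Suc i)) \<Longrightarrow>
    C k = P \<Longrightarrow> k \<le> N"
  shows "prime_height R P \<le> enat N"
  unfolding prime_height_def
proof (rule Sup_least)
  fix x assume "x \<in> {enat k | k. \<exists>C. (\<forall>i\<le>k. primeideal (C i) R) \<and> (\<forall>i<k. C i \<subset> C (Suc i)) \<and> C k = P}"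
  then obtain k C where "x = enat k" "\<forall>i\<le>k. primeideal (C i) R" "\<forall>i<k. C i \<subset> C (Suc i)" "C k = P"
    by blast
  then show "x \<le> enat N" using assms[of k C] by simp
qed

text \<open>The chain only has to end inside \<open>P\<close>: replacing its last member by
  \<open>P\<close> keeps every inclusion strict.\<close>

lemma prime_height_ge:
  assumes "primeideal P R" "\<And>i. i \<le> k \<Longrightarrow> primeideal (C i) R"
    and "\<And>i. i < k \<Longrightarrow> C i \<subset> C (Suc i)" "C k \<subseteq> P"
  shows "enat k \<le> prime_height R P"
  unfolding prime_height_def
proof (rule Sup_upper, intro CollectI exI conjI)
  let ?D = "C(k := P)"
  show "\<forall>i\<le>k. primeideal (?D i) R" using assms(1,2) by simp
  show "\<forall>i<k. ?D i \<subset> ?D (Suc i)"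
  proof (intro allI impI)
    fix i assume i: "i < k"
    show "?D i \<subset> ?D (Suc i)"
      using assms(3)[OF i] assms(4) i by (cases "Suc i = k") auto
  qed
qed simp_all

section \<open>Primes generated by variables\<close>

definition vanish :: "nat set \<Rightarrow> nat \<Rightarrow> 'k::field mpoly" where
  "vanish Z i = (if i \<in> Z then 0 else X i)"

text \<open>For \<open>Z\<close> within \<open>{1..n + 1}\<close> the kernel is the prime generated
  by the variables with index in \<open>Z\<close>. The variable \<open>X j\<close> witnesses
  strictness.\<close>

lemma subst_kernel_vanish_psubset:
  assumes "Z \<subseteq> Z'" "j \<in> Z'" "j \<notin> Z" "1 \<le> j" "j \<le> n + 1"
  shows "subst_kernel n (vanish Z :: nat \<Rightarrow> 'k::field mpoly) \<subset> subst_kernel n (vanish Z')"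
proof (rule subst_kernel_psubset)
  show "vanish Z' i = subst (vanish Z') (vanish Z i :: 'k mpoly)" for i
    using assms(1) by (auto simp: vanish_def)
  have "lookup (X j :: 'k mpoly) (single j 1) \<noteq> 0" by (simp add: X_def)
  then have "X j \<noteq> (0 :: 'k mpoly)" by auto
  then show "X j \<in> poly_carrier n" "subst (vanish Z') (X j :: 'k mpoly) = 0"
    "subst (vanish Z) (X j :: 'k mpoly) \<noteq> 0"
    using assms by (simp_all add: vanish_def)
qed

text \<open>Adjoining first \<open>X 1\<close> and then \<open>X (n + 1)\<close> prolongs any chain
  that ends here by two steps, and no chain has more than \<open>n + 1\<close> steps.\<close>

lemma prime_height_coordinate_prime_le:
  assumes "1 \<le> n"
  shows "prime_height (poly_ring n) (subst_kernel n (vanish {2..n} :: nat \<Rightarrow> 'k::field mpoly))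
    \<le> enat (n - 1)"
proof (rule prime_height_le)
  fix k and C :: "nat \<Rightarrow> 'k mpoly set"
  assume C: "\<And>i. i \<le> k \<Longrightarrow> primeideal (C i) (poly_ring n)" "\<And>i. i < k \<Longrightarrow> C i \<subset> C (Suc i)"
    "C k = subst_kernel n (vanish {2..n})"
  define D where "D i = (if i \<le> k then C i else if i = k + 1 then subst_kernel n (vanish {1..n})
    else subst_kernel n (vanish {1..n + 1}))" for i
  have "k + 2 \<le> n + 1"
  proof (rule prime_chain_length_le[of _ D])
    show "primeideal (D i) (poly_ring n)" if "i \<le> k + 2" for i
      using C(1) by (simp add: D_def primeideal_subst_kernel)
    show "D i \<subset> D (Suc i)" if "i < k + 2" for i
    proof -
      consider "i < k" | "i = k" | "i = k + 1" using \<open>i < k + 2\<close> by linarith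
      then show ?thesis
      proof cases
        case 1
        then show ?thesis using C(2) by (simp add: D_def)
      next
        case 2
        then show ?thesis
          using C(3) subst_kernel_vanish_psubset[of "{2..n}" "{1..n}" 1 n] assms
          by (simp add: D_def)
      next
        case 3
        then show ?thesis
          using subst_kernel_vanish_psubset[of "{1..n}" "{1..n + 1}" "n + 1" n] assms
          by (simp add: D_def)
      qed
    qed
  qed
  then show "k \<le> n - 1" by simp
qed

text \<open>Exchanging one factor at a time changes the product by a multiple of some
  \<open>f i - g i\<close>.\<close>

lemma prod_diff_mem_ideal:
  assumes I: "ideal I (poly_ring n)"
    and fg: "\<And>i. i \<in> S \<Longrightarrow> f i \<in> poly_carrier n" "\<And>i. i \<in> S \<Longrightarrow> g i \<in> poly_carrier n"
      "\<And>i. i \<in> S \<Longrightarrow> f i - g i \<in> I"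
  shows "prod f S - prod g S \<in> I"
  using fg
proof (induction S rule: infinite_finite_induct)
  case (insert i S)
  have "prod f (insert i S) - prod g (insert i S)
      = f i * (prod f S - prod g S) + prod g S * (f i - g i)"
    using insert by (simp add: algebra_simps)
  moreover have "prod g S \<in> poly_carrier n" using insert by (intro poly_carrier_prod) simp
  ultimately show ?case
    using insert ideal_poly_ringD(3,4)[OF I] by simp
qed (simp_all add: ideal_poly_ringD(2)[OF I])

lemma monom_eval_diff_mem_ideal:
  assumes I: "ideal I (poly_ring n)" and m: "keys m \<subseteq> {1..n + 1}"
    and st: "\<And>i. i \<in> {1..n + 1} \<Longrightarrow> \<sigma> i \<in> poly_carrier n"
      "\<And>i. i \<in> {1..n + 1} \<Longrightarrow> \<tau> i \<in> poly_carrier n"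
      "\<And>i. i \<in> {1..n + 1} \<Longrightarrow> \<sigma> i - \<tau> i \<in> I"
  shows "monom_eval \<sigma> m - monom_eval \<tau> m \<in> I"
proof -
  have "\<sigma> i ^ k - \<tau> i ^ k \<in> I" if "i \<in> {1..n + 1}" for i k
    using prod_diff_mem_ideal[OF I, of "{..<k}" "\<lambda>_. \<sigma> i" "\<lambda>_. \<tau> i"] st that by simp
  then show ?thesis
    unfolding monom_eval_def using m st
    by (intro prod_diff_mem_ideal[OF I] poly_carrier_power) blast+
qed

lemma subst_X_id: "subst X p = p"
proof -
  have "monom_eval X = (\<lambda>m. single m (1 :: 'a))" by (rule ext) (rule monom_eval_X)
  then show ?thesis by (simp add: subst_def lin_monomials)
qed

text \<open>Modulo \<open>I\<close> the substitution \<open>vanish Z\<close> agrees with the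
  identity, so \<open>p\<close> is congruent to its image, which is zero.\<close>

lemma subst_kernel_vanish_subset:
  fixes I :: "'k::field mpoly set"
  assumes I: "ideal I (poly_ring n)" and Z: "\<And>i. i \<in> Z \<Longrightarrow> X i \<in> I"
  shows "subst_kernel n (vanish Z) \<subseteq> I"
proof
  fix p :: "'k mpoly" assume "p \<in> subst_kernel n (vanish Z)"
  then have p: "p \<in> poly_carrier n" "subst (vanish Z) p = 0" by (auto simp: subst_kernel_def)
  have "monom_eval X m - monom_eval (vanish Z) m \<in> I" if "m \<in> keys p" for m
  proof (rule monom_eval_diff_mem_ideal[OF I])
    show "keys m \<subseteq> {1..n + 1}" using that p(1) by (auto simp: poly_carrier_def)
  qed (use Z in \<open>auto simp: vanish_def ideal_poly_ringD(2)[OF I]\<close>)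
  then have "(\<Sum>m\<in>keys p. cst (lookup p m) * (monom_eval X m - monom_eval (vanish Z) m)) \<in> I"
    by (intro ideal_poly_ring_sum[OF I] ideal_poly_ringD(4)[OF I]) simp_all
  then have "subst X p - subst (vanish Z) p \<in> I"
    by (simp add: subst_def lin_def sum_subtractf right_diff_distrib)
  then show "p \<in> I" using p(2) by (simp add: subst_X_id)
qed

section \<open>The ideal of the rational normal curve\<close>

lemma X_power: "X i ^ k = (single (single i k) 1 :: 'k::field mpoly)"
  using monom_eval_X[of "single i k"] by simp

text \<open>\<open>X i\<close> has weight \<open>i - 1\<close>, its exponent of the parameter
  \<open>X 2\<close> on the curve with coordinates \<open>X 1 * X 2 ^ (i - 1)\<close>.\<close>

definition weight :: "(nat \<Rightarrow>\<^sub>0 nat) \<Rightarrow> nat" where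
  "weight m = (\<Sum>i\<in>keys m. (i - 1) * lookup m i)"

lemma monom_eval_weighted: "monom_eval (\<lambda>i. X 1 ^ (i - 1) * X i) m = X 1 ^ weight m * monom_eval X m"
  by (simp add: monom_eval_def weight_def power_sum power_mult power_mult_distrib prod.distrib)

lemma monom_eval_toric:
  "monom_eval (\<lambda>i. X 1 * X 2 ^ (i - 1)) m
    = (single (single 1 (monom_degree m) + single 2 (weight m)) 1 :: 'k::field mpoly)"
proof -
  have "monom_eval (\<lambda>i. X 1 * X 2 ^ (i - 1)) m
      = X 1 ^ monom_degree m * (X 2 ^ weight m :: 'k mpoly)"
    by (simp add: monom_eval_def weight_def monom_degree_def power_sum power_mult
        power_mult_distrib prod.distrib)
  then show ?thesis by (simp add: X_power mult_single)
qed

text \<open>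
  Modulo \<open>P\<close>, the monomial \<open>m\<close> times \<open>x\<^sub>1\<close> to the power \<^term>\<open>weight m\<close> is the image of \<open>m\<close> under
  \<open>x\<^sub>i \<mapsto> x\<^sub>1 x\<^sub>2\<^bsup>i-1\<^esup>\<close>. That image determines the weight, so in \<open>x\<^sub>1\<^bsup>N\<^esup> f\<close> the missing powers of \<open>x\<^sub>1\<close>
  can be restored by a linear map applied to the image of \<open>f\<close>, which is zero.
\<close>

lemma subst_kernel_toric_subset:
  fixes P :: "'k::field mpoly set"
  assumes P: "primeideal P (poly_ring n)" and n: "1 \<le> n" and X1: "X 1 \<notin> P"
    and rel: "\<And>i. 1 \<le> i \<Longrightarrow> i \<le> n + 1 \<Longrightarrow> X 1 ^ (i - 1) * X i - X 1 * X 2 ^ (i - 1) \<in> P"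
  shows "subst_kernel n (\<lambda>i. X 1 * X 2 ^ (i - 1)) \<subseteq> P"
proof
  note I = primeideal_poly_ringD(1)[OF P]
  let ?\<sigma> = "\<lambda>i. X 1 ^ (i - 1) * X i :: 'k mpoly" and ?\<tau> = "\<lambda>i. X 1 * X 2 ^ (i - 1) :: 'k mpoly"
  fix f assume "f \<in> subst_kernel n ?\<tau>"
  then have f: "f \<in> poly_carrier n" "subst ?\<tau> f = 0" by (auto simp: subst_kernel_def)
  define N where "N = (\<Sum>m\<in>keys f. weight m)"
  have N: "weight m \<le> N" if "m \<in> keys f" for m
    using that by (simp add: N_def member_le_sum)
  define A :: "(nat \<Rightarrow>\<^sub>0 nat) \<Rightarrow> (nat \<Rightarrow>\<^sub>0 nat)"
    where "A m = single 1 (monom_degree m) + single 2 (weight m)" for m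
  have A: "monom_eval ?\<tau> m = single (A m) 1" "lookup (A m) 2 = weight m" for m
    by (simp_all only: A_def monom_eval_toric) (simp add: lookup_add lookup_single)
  define g :: "(nat \<Rightarrow>\<^sub>0 nat) \<Rightarrow> 'k mpoly" where "g \<mu> = X 1 ^ (N - lookup \<mu> 2) * single \<mu> 1" for \<mu>
  have "monom_eval ?\<tau> = (\<lambda>m. single (A m) 1)" using A(1) by (rule ext)
  then have "lin (\<lambda>m. single (A m) 1) f = 0" using f(2) unfolding subst_def by simp
  then have zero: "lin (\<lambda>m. g (A m)) f = 0" using lin_lin_single[of g A f] by simp
  have "X 1 ^ N * f = X 1 ^ N * lin (monom_eval X) f"
    using subst_X_id[of f] by (simp add: subst_def)
  also have "\<dots> = (\<Sum>m\<in>keys f. cst (lookup f m) * (X 1 ^ (N - weight m) * monom_eval ?\<sigma> m))"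
    unfolding lin_def sum_distrib_left
  proof (rule sum.cong)
    fix m assume "m \<in> keys f"
    then have "X 1 ^ N = (X 1 ^ (N - weight m) * X 1 ^ weight m :: 'k mpoly)"
      using N by (simp flip: power_add)
    then show "X 1 ^ N * (cst (lookup f m) * monom_eval X m)
        = cst (lookup f m) * (X 1 ^ (N - weight m) * monom_eval ?\<sigma> m)"
      unfolding monom_eval_weighted by (simp only: ac_simps)
  qed simp
  \<comment> \<open>The subtracted term is zero by \<open>zero\<close>; it supplies the second half
    of each difference of monomials.\<close>
  also have "\<dots> - lin (\<lambda>m. g (A m)) f = (\<Sum>m\<in>keys f. cst (lookup f m) *
      (X 1 ^ (N - weight m) * (monom_eval ?\<sigma> m - monom_eval ?\<tau> m)))"
    unfolding lin_def sum_subtractf[symmetric]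
    by (simp add: g_def A(2) right_diff_distrib del: cst_mult_single flip: A(1))
  also have "\<dots> \<in> P"
  proof (rule ideal_poly_ring_sum[OF I])
    fix m assume "m \<in> keys f"
    then have "keys m \<subseteq> {1..n + 1}" using f(1) by (auto simp: poly_carrier_def)
    then have "monom_eval ?\<sigma> m - monom_eval ?\<tau> m \<in> P"
      using n rel
      by (intro monom_eval_diff_mem_ideal[OF I] poly_carrier_mult poly_carrier_power) auto
    then show "cst (lookup f m) * (X 1 ^ (N - weight m) * (monom_eval ?\<sigma> m - monom_eval ?\<tau> m)) \<in> P"
      by (intro ideal_poly_ringD(4)[OF I] poly_carrier_power) simp_all
  qed
  finally have "X 1 ^ N * f \<in> P" using zero by simp
  then have "X 1 ^ N \<in> P \<or> f \<in> P"
    using primeideal_poly_ringD(3)[OF P, of "X 1 ^ N" f] f(1) by (simp add: poly_carrier_power)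
  then show "f \<in> P" using primeideal_power[OF P, of "X 1" N] X1 by auto
qed

text \<open>The first \<open>k + 2\<close> variables are placed on the curve and the others stay
  free. For \<open>k = 0\<close> the substitution is still injective; for \<open>k = n - 1\<close>
  all \<open>n + 1\<close> variables are on the curve.\<close>

definition toric :: "nat \<Rightarrow> nat \<Rightarrow> 'k::field mpoly" where
  "toric k i = (if i \<le> k + 2 then X 1 * X 2 ^ (i - 1) else X i)"

lemma subst_kernel_toric_psubset:
  assumes "k + 3 \<le> n + 1"
  shows "subst_kernel n (toric k :: nat \<Rightarrow> 'k::field mpoly) \<subset> subst_kernel n (toric (Suc k))"
proof (rule subst_kernel_psubset)
  \<comment> \<open>The relation \<open>X (k + 1) * X (k + 3) - X (k + 2) ^ 2\<close> begins to hold
    when \<open>X (k + 3)\<close> joins the curve.\<close>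
  let ?p = "hankel_binomial (k + 1) (k + 2) :: 'k mpoly"
  let ?\<rho> = "\<lambda>i. if i = k + 3 then X 1 * X 2 ^ (k + 2) else X i :: 'k mpoly"
  show "toric (Suc k) i = subst ?\<rho> (toric k i)" for i
    by (auto simp: toric_def subst_mult subst_power le_Suc_eq numeral_eq_Suc)
  show "?p \<in> poly_carrier n"
    using assms by (auto simp: hankel_binomial_def intro!: poly_carrier_diff poly_carrier_mult)
  show "subst (toric (Suc k)) ?p = 0"
    by (simp add: hankel_binomial_def subst_diff subst_mult toric_def)
  show "subst (toric k) ?p \<noteq> 0"
  proof
    assume "subst (toric k) ?p = 0"
    \<comment> \<open>At the point where \<open>X (k + 3)\<close> is \<open>0\<close> and all other
      variables are \<open>1\<close>, the image of the binomial takes the value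
      \<open>- 1\<close>.\<close>
    then have "subst (\<lambda>i. if i = k + 3 then 0 else 1) (subst (toric k) ?p) = (0 :: 'k mpoly)" by simp
    then show False
      by (simp add: hankel_binomial_def subst_diff subst_mult subst_power toric_def)
  qed
qed

section \<open>Primes over the ideal of the path\<close>

lemma prime_over_path_cases:
  fixes P :: "'k::field mpoly set"
  assumes P: "primeideal P (poly_ring n)" and n: "1 \<le> n"
    and g: "\<And>i. 1 \<le> i \<Longrightarrow> i < n \<Longrightarrow> hankel_binomial i (i + 1) \<in> P"
  shows "(\<forall>i\<in>{2..n}. X i \<in> P) \<or> subst_kernel n (\<lambda>i. X 1 * X 2 ^ (i - 1)) \<subseteq> P"
proof (cases "\<exists>j\<in>{1..n + 1}. X j \<in> P")
  case True
  note I = primeideal_poly_ringD(1)[OF P]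
  from True obtain j where j: "1 \<le> j" "j \<le> n + 1" "X j \<in> P" by auto
  have square: "X (i + 1) \<in> P" if "1 \<le> i" "i < n" "X i * X (i + 2) \<in> P" for i
  proof -
    have "X (i + 1) ^ 2 = X i * X (i + 2) - (hankel_binomial i (i + 1) :: 'k mpoly)"
      by (simp add: hankel_binomial_def power2_eq_square)
    also have "\<dots> \<in> P" using ideal_poly_ringD(5)[OF I that(3) g[OF that(1,2)]] .
    finally show ?thesis using primeideal_power[OF P, of "X (i + 1)" 2] that by simp
  qed
  \<comment> \<open>Membership spreads to larger indices, since a prime containing a square contains
    its root. It stops at \<open>n\<close>: \<open>X (n + 1)\<close> is the middle variable of no
    relation.\<close>
  have up: "X (j + d) \<in> P" if "j + d \<le> n" for d
    using that
  proof (induction d)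
    case (Suc d)
    then have "X (j + d) * X (j + d + 2) \<in> P"
      using ideal_poly_ringD(4)[OF I, of "X (j + d)" "X (j + d + 2)"] by (simp add: mult.commute)
    then show ?case using square[of "j + d"] Suc.prems j(1) by simp
  qed (use j in simp)
  \<comment> \<open>Likewise towards smaller indices, down to \<open>2\<close>; the guard also keeps
    the subtraction from being truncated.\<close>
  have down: "X (j - d) \<in> P" if "2 \<le> j - d" for d
    using that
  proof (induction d)
    case (Suc d)
    define i where "i = j - d - 2"
    have i: "j - d = i + 2" "j - Suc d = i + 1" "1 \<le> i" "i < n" using Suc.prems j by (auto simp: i_def)
    then have "X (i + 2) \<in> P" using Suc by simp
    then have "X i * X (i + 2) \<in> P"
      using ideal_poly_ringD(4)[OF I, of "X (i + 2)" "X i"] i by simp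
    then show ?case using square[of i] i by simp
  qed (use j in simp)
  have "X i \<in> P" if "i \<in> {2..n}" for i
    using up[of "i - j"] down[of "j - i"] that by (cases "j \<le> i") auto
  then show ?thesis by blast
next
  case False
  note I = primeideal_poly_ringD(1)[OF P]
  note closed = ideal_poly_ringD(3,4)[OF I]
  \<comment> \<open>Modulo \<open>P\<close> all ratios of consecutive variables equal that of
    \<open>X 2\<close> to \<open>X 1\<close>. The induction step cancels \<open>X (i + 1)\<close>,
    which is not in \<open>P\<close>.\<close>
  have ratio: "X 1 * X (i + 2) - X 2 * X (i + 1) \<in> P" if "i + 1 \<le> n" for i
    using that
  proof (induction i)
    case 0
    then show ?case
      using ideal_poly_ringD(2)[OF I] by (simp add: mult.commute numeral_2_eq_2)
  next
    case (Suc i)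
    have "X (i + 1) * (X 1 * X (i + 3) - X 2 * X (i + 2)) = X 1 * hankel_binomial (i + 1) (i + 2)
        + X (i + 2) * (X 1 * X (i + 2) - X 2 * X (i + 1) :: 'k mpoly)"
      by (simp add: hankel_binomial_def algebra_simps numeral_eq_Suc)
    also have "\<dots> \<in> P"
      using Suc g[of "i + 1"] n by (intro closed) (simp_all add: numeral_eq_Suc)
    finally have "X (i + 1) * (X 1 * X (i + 3) - X 2 * X (i + 2)) \<in> P" .
    moreover have "X 1 * X (i + 3) - X 2 * X (i + 2) \<in> (poly_carrier n :: 'k mpoly set)"
      using Suc.prems by (intro poly_carrier_diff poly_carrier_mult) simp_all
    ultimately have "X (i + 1) \<in> P \<or> X 1 * X (i + 3) - X 2 * X (i + 2) \<in> P"
      using primeideal_poly_ringD(3)[OF P, of "X (i + 1)"] Suc.prems by simp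
    then show ?case using False Suc.prems by (auto simp: numeral_eq_Suc)
  qed
  \<comment> \<open>Multiplying the first \<open>i\<close> ratios gives the parametrization of the
    curve with denominators cleared.\<close>
  have rel: "X 1 ^ i * X (i + 1) - X 1 * X 2 ^ i \<in> P" if "i \<le> n" for i
    using that
  proof (induction i)
    case 0
    then show ?case using ideal_poly_ringD(2)[OF I] by simp
  next
    case (Suc i)
    have "X 1 ^ Suc i * X (Suc i + 1) - X 1 * X 2 ^ Suc i
        = X 1 ^ i * (X 1 * X (i + 2) - X 2 * X (i + 1))
          + X 2 * (X 1 ^ i * X (i + 1) - X 1 * X 2 ^ i :: 'k mpoly)"
      by (simp add: algebra_simps)
    also have "\<dots> \<in> P"
      using Suc ratio[of i] n by (intro closed poly_carrier_power) simp_all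
    finally show ?case .
  qed
  have "X 1 ^ (i - 1) * X i - X 1 * X 2 ^ (i - 1) \<in> P" if "1 \<le> i" "i \<le> n + 1" for i
    using rel[of "i - 1"] that by simp
  then show ?thesis
    using subst_kernel_toric_subset[OF P n] False by auto
qed

lemma monom_eval_cong: "(\<And>i. i \<in> keys m \<Longrightarrow> \<sigma> i = \<tau> i) \<Longrightarrow> monom_eval \<sigma> m = monom_eval \<tau> m"
  unfolding monom_eval_def by (intro prod.cong) simp_all

lemma subst_kernel_cong:
  assumes "\<And>i. i \<in> {1..n + 1} \<Longrightarrow> \<sigma> i = \<tau> i"
  shows "subst_kernel n \<sigma> = subst_kernel n \<tau>"
proof -
  have "subst \<sigma> p = subst \<tau> p" if "p \<in> poly_carrier n" for p
    unfolding subst_def lin_def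
  proof (rule sum.cong)
    fix m assume "m \<in> keys p"
    then have "keys m \<subseteq> {1..n + 1}" using that by (auto simp: poly_carrier_def)
    then show "cst (lookup p m) * monom_eval \<sigma> m = cst (lookup p m) * monom_eval \<tau> m"
      using monom_eval_cong[of m \<sigma> \<tau>] assms by (metis subset_iff)
  qed simp
  then show ?thesis by (auto simp: subst_kernel_def)
qed

lemma prime_height_over_path_ge:
  fixes P :: "'k::field mpoly set"
  assumes P: "primeideal P (poly_ring n)" and n: "1 \<le> n"
    and g: "\<And>i. 1 \<le> i \<Longrightarrow> i < n \<Longrightarrow> hankel_binomial i (i + 1) \<in> P"
  shows "enat (n - 1) \<le> prime_height (poly_ring n) P"
proof -
  consider "\<forall>i\<in>{2..n}. X i \<in> P" | "subst_kernel n (\<lambda>i. X 1 * X 2 ^ (i - 1)) \<subseteq> P"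
    using prime_over_path_cases[OF assms] by blast
  then show ?thesis
  proof cases
    case 1
    show ?thesis
    \<comment> \<open>The set \<open>{2..k + 1}\<close> is empty for \<open>k = 0\<close> and gains
      one index per step until it is \<open>{2..n}\<close> at \<open>k = n - 1\<close>.\<close>
    proof (rule prime_height_ge[OF P, of _ "\<lambda>k. subst_kernel n (vanish {2..k + 1})"])
      show "subst_kernel n (vanish {2..i + 1} :: nat \<Rightarrow> 'k mpoly) \<subset> subst_kernel n (vanish {2..Suc i + 1})"
        if "i < n - 1" for i
        using that by (intro subst_kernel_vanish_psubset[of _ _ "i + 2"]) auto
      show "subst_kernel n (vanish {2..n - 1 + 1}) \<subseteq> P"
        using 1 n by (intro subst_kernel_vanish_subset primeideal_poly_ringD(1)[OF P]) simp
    qed (rule primeideal_subst_kernel)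
  next
    case 2
    show ?thesis
    proof (rule prime_height_ge[OF P, of _ "\<lambda>k. subst_kernel n (toric k)"])
      show "subst_kernel n (toric i :: nat \<Rightarrow> 'k mpoly) \<subset> subst_kernel n (toric (Suc i))"
        if "i < n - 1" for i
        using that by (intro subst_kernel_toric_psubset) simp
      have "subst_kernel n (toric (n - 1)) = subst_kernel n (\<lambda>i. X 1 * X 2 ^ (i - 1) :: 'k mpoly)"
        using n by (intro subst_kernel_cong) (auto simp: toric_def)
      then show "subst_kernel n (toric (n - 1)) \<subseteq> P" using 2 by simp
    qed (rule primeideal_subst_kernel)
  qed
qed

section \<open>Number of generators\<close>

lemma monom_degree_superset:
  "finite S \<Longrightarrow> keys m \<subseteq> S \<Longrightarrow> monom_degree m = (\<Sum>i\<in>S. lookup m i)"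
  unfolding monom_degree_def by (intro sum.mono_neutral_left) (auto simp: in_keys_iff)

lemma monom_degree_add: "monom_degree (a + b) = monom_degree a + monom_degree b"
  using keys_add[of a b]
  by (simp add: monom_degree_superset[of "keys a \<union> keys b"] lookup_add sum.distrib)

lemma monom_degree_single [simp]: "monom_degree (single i k) = k"
  by (simp add: monom_degree_superset[of "{i}"])

lemma monom_degree_eq_0_iff [simp]: "monom_degree m = 0 \<longleftrightarrow> m = 0"
  by (auto simp: monom_degree_def in_keys_iff intro!: poly_mapping_eqI)

definition pair_monom :: "nat \<Rightarrow> nat \<Rightarrow> nat \<Rightarrow>\<^sub>0 nat" where
  "pair_monom a b = single a 1 + single b 1"

lemma monom_degree_pair_monom [simp]: "monom_degree (pair_monom a b) = 2"
  by (simp add: pair_monom_def monom_degree_add)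

lemma pair_monom_eq_iff:
  "pair_monom a b = pair_monom c d \<longleftrightarrow> a = c \<and> b = d \<or> a = d \<and> b = c"
proof
  assume eq: "pair_monom a b = pair_monom c d"
  have "(1 when a = x) + (1 when b = x) = (1 when c = x) + (1 when d = x :: nat)" for x
    using arg_cong[OF eq, of "\<lambda>m. lookup m x"] by (simp add: pair_monom_def lookup_add lookup_single)
  from this[of a] this[of b] this[of c] show "a = c \<and> b = d \<or> a = d \<and> b = c"
    by (auto simp: when_def split: if_splits)
qed (auto simp: pair_monom_def add.commute)

lemma hankel_binomial_eq:
  "hankel_binomial i j
    = (single (pair_monom i (j + 1)) 1 - single (pair_monom j (i + 1)) 1 :: 'k::field mpoly)"
  by (simp add: hankel_binomial_def X_def pair_monom_def mult_single)

lemma keys_hankel_binomial: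
  "keys (hankel_binomial i j :: 'k::field mpoly) \<subseteq> {pair_monom i (j + 1), pair_monom j (i + 1)}"
  unfolding hankel_binomial_eq
  using keys_diff[of "single (pair_monom i (j + 1)) (1::'k)" "single (pair_monom j (i + 1)) 1"]
  by (auto split: if_splits)

lemma homogeneous_hankel_binomial: "homogeneous (hankel_binomial i j)"
  unfolding homogeneous_def using keys_hankel_binomial[of i j] by (intro exI[of _ 2]) auto

lemma hankel_binomial_carrier:
  assumes "1 \<le> i" "i \<le> n" "1 \<le> j" "j \<le> n"
  shows "hankel_binomial i j \<in> poly_carrier n"
  using assms by (auto simp: hankel_binomial_def intro!: poly_carrier_diff poly_carrier_mult)

lemma lookup_hankel_binomial_lead:
  assumes "i < j"
  shows "lookup (hankel_binomial i j :: 'k::field mpoly) (pair_monom i (j + 1)) = 1"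
  using assms by (simp add: hankel_binomial_eq lookup_minus lookup_single pair_monom_eq_iff when_def)

text \<open>The indices in \<open>pair_monom i (j + 1)\<close> are \<open>j - i + 1\<close> apart,
  those in the two monomials of the other binomial \<open>j' - i' + 1\<close> and
  \<open>j' - i' - 1\<close>. The second distance is too small, and a match with the first forces
  equal pairs.\<close>

lemma lookup_hankel_binomial_other:
  assumes "i < j" "i' < j'" "(i', j') \<noteq> (i, j)" "j' - i' \<le> j - i"
  shows "lookup (hankel_binomial i' j' :: 'k::field mpoly) (pair_monom i (j + 1)) = 0"
  using assms
  by (auto simp: hankel_binomial_eq lookup_minus lookup_single pair_monom_eq_iff when_def)

text \<open>Among the pairs with nonzero coefficient take one of largest gap \<open>j - i\<close>.
  Its monomial \<open>pair_monom i (j + 1)\<close> occurs in no other such binomial, so its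
  coefficient cannot cancel.\<close>

lemma hankel_binomials_independent:
  fixes u :: "nat \<times> nat \<Rightarrow> 'k::field"
  assumes E: "finite E" "\<And>i j. (i, j) \<in> E \<Longrightarrow> i < j"
    and sum: "(\<Sum>e\<in>E. cst (u e) * case_prod hankel_binomial e) = 0"
  shows "\<forall>e\<in>E. u e = 0"
proof (rule ccontr)
  let ?gap = "\<lambda>e :: nat \<times> nat. snd e - fst e"
  let ?S = "{e \<in> E. u e \<noteq> 0}"
  assume "\<not> (\<forall>e\<in>E. u e = 0)"
  then have S: "finite ?S" "?S \<noteq> {}" using E(1) by auto
  then have "Max (?gap ` ?S) \<in> ?gap ` ?S" by (intro Max_in) auto
  then obtain i j where ij: "(i, j) \<in> E" "u (i, j) \<noteq> 0" "j - i = Max (?gap ` ?S)" by auto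
  have max: "?gap e \<le> j - i" if "e \<in> ?S" for e
    unfolding ij(3) using S(1) that by (intro Max_ge) auto
  let ?\<mu> = "pair_monom i (j + 1)"
  have "0 = lookup (\<Sum>e\<in>E. cst (u e) * case_prod hankel_binomial e :: 'k mpoly) ?\<mu>"
    by (simp add: sum)
  also have "\<dots> = (\<Sum>e\<in>E. u e * lookup (case_prod hankel_binomial e :: 'k mpoly) ?\<mu>)"
    by (simp add: lookup_sum)
  also have "\<dots> = (\<Sum>e\<in>{(i, j)}. u e * lookup (case_prod hankel_binomial e :: 'k mpoly) ?\<mu>)"
  proof (rule sum.mono_neutral_right[OF E(1)], use ij in simp, rule ballI)
    fix e assume e: "e \<in> E - {(i, j)}"
    obtain i' j' where [simp]: "e = (i', j')" by (cases e)
    show "u e * lookup (case_prod hankel_binomial e :: 'k mpoly) ?\<mu> = 0"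
    proof (cases "u e = 0")
      case False
      then have "j' - i' \<le> j - i" using max[of e] e by simp
      then have "lookup (hankel_binomial i' j' :: 'k mpoly) ?\<mu> = 0"
        using e E(2) ij(1) by (intro lookup_hankel_binomial_other) auto
      then show ?thesis by simp
    qed simp
  qed
  also have "\<dots> = u (i, j)" using lookup_hankel_binomial_lead[where ?'k = 'k, OF E(2)[OF ij(1)]] by simp
  finally show False using ij(2) by simp
qed

section \<open>Quadratic parts and the size of generating sets\<close>

definition quadratic_part :: "'k::field mpoly \<Rightarrow> 'k mpoly" where
  "quadratic_part = lin (\<lambda>m. if monom_degree m = 2 then single m 1 else 0)"

lemma quadratic_part_0 [simp]: "quadratic_part 0 = 0"
  and quadratic_part_add: "quadratic_part (p + q) = quadratic_part p + quadratic_part q"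
  and quadratic_part_cst_mult: "quadratic_part (cst c * p) = cst c * quadratic_part p"
  by (simp_all add: quadratic_part_def lin_add lin_cst_mult)

lemma quadratic_part_id:
  assumes "\<And>m. m \<in> keys p \<Longrightarrow> monom_degree m = 2"
  shows "quadratic_part p = p"
proof -
  have "quadratic_part p = lin (\<lambda>m. single m 1) p"
    unfolding quadratic_part_def lin_def using assms by (intro sum.cong) auto
  then show ?thesis by (simp add: lin_monomials)
qed

lemma quadratic_part_eq_0:
  assumes "\<And>m. m \<in> keys p \<Longrightarrow> monom_degree m \<noteq> 2"
  shows "quadratic_part p = 0"
  unfolding quadratic_part_def lin_def using assms by (intro sum.neutral) auto

text \<open>Since \<open>f\<close> has order at least two, every nonconstant term of
  \<open>r\<close> only contributes in degree three and above.\<close>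

lemma quadratic_part_mult:
  fixes r f :: "'k::field mpoly"
  assumes f: "\<And>m. m \<in> keys f \<Longrightarrow> 2 \<le> monom_degree m"
  shows "quadratic_part (r * f) = cst (lookup r 0) * quadratic_part f"
proof (induction r rule: mpoly_induct)
  case (single m c)
  show ?case
  proof (cases "m = 0")
    case True
    then show ?thesis using quadratic_part_cst_mult[of c f] by (simp add: cst_def)
  next
    case False
    have "quadratic_part (single m c * f) = 0"
    proof (rule quadratic_part_eq_0)
      fix k assume "k \<in> keys (single m c * f)"
      then obtain b where "b \<in> keys f" "k = m + b"
        using keys_mult[of "single m c" f] by (auto split: if_splits)
      moreover have "monom_degree m \<noteq> 0" using False by simp
      ultimately show "monom_degree k \<noteq> 2" using f[of b] by (simp add: monom_degree_add del: monom_degree_eq_0_iff)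
    qed
    then show ?thesis using False by (simp add: lookup_single)
  qed
qed (simp_all add: algebra_simps quadratic_part_add lookup_add cst_add)

text \<open>
  All elements of the ideal have order at least two, so the quadratic part of a combination of
  generators is the same combination with constant coefficients of their quadratic parts.
\<close>

lemma card_le_card_generators:
  fixes B :: "'k::field mpoly set"
  assumes E: "finite E" "\<And>i j. (i, j) \<in> E \<Longrightarrow> 1 \<le> i \<and> i < j \<and> j \<le> n"
    and B: "finite B" "B \<subseteq> poly_carrier n"
    and gen: "genideal (poly_ring n) B = genideal (poly_ring n) (case_prod hankel_binomial ` E)"
  shows "card E \<le> card B"
proof -
  interpret R: ring "poly_ring n :: 'k mpoly ring" by (rule ring_poly_ring)
  interpret V: vector_space "\<lambda>c p. cst c * p :: 'k mpoly" by (rule vector_space_cst)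
  let ?h = "case_prod hankel_binomial :: nat \<times> nat \<Rightarrow> 'k mpoly"
  let ?M = "{p \<in> poly_carrier n. \<forall>m\<in>keys p. 2 \<le> monom_degree m} :: 'k mpoly set"
  let ?T = "quadratic_part ` B"
  \<comment> \<open>\<open>?J\<close> is an ideal because on \<open>?M\<close> multiplication by
    \<open>r\<close> merely scales quadratic parts. It contains \<open>B\<close>, hence every
    binomial of \<open>E\<close>.\<close>
  let ?J = "{p \<in> ?M. quadratic_part p \<in> V.span ?T}"
  have hM: "?h ` E \<subseteq> ?M"
  proof clarify
    fix i j assume "(i, j) \<in> E"
    then show "hankel_binomial i j \<in> poly_carrier n \<and>
        (\<forall>m\<in>keys (hankel_binomial i j :: 'k mpoly). 2 \<le> monom_degree m)"
      using E(2)[of i j] keys_hankel_binomial[of i j] by (auto intro!: hankel_binomial_carrier)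
  qed
  have add: "p + q \<in> ?M" if "p \<in> ?M" "q \<in> ?M" for p q
    using that keys_add[of p q] poly_carrier_add[of p n q] by blast
  have mult: "r * p \<in> ?M" if "p \<in> ?M" "r \<in> poly_carrier n" for p r
  proof -
    have "2 \<le> monom_degree m" if m: "m \<in> keys (r * p)" for m
    proof -
      obtain a b where "b \<in> keys p" "m = a + b" using m keys_mult[of r p] by blast
      then show ?thesis using \<open>p \<in> ?M\<close> by (auto simp: monom_degree_add intro: trans_le_add2)
    qed
    then show ?thesis using that poly_carrier_mult[of r n p] by blast
  qed
  have "ideal ?M (poly_ring n)"
    by (rule ideal_poly_ringI[OF _ _ add mult]) auto
  then have "genideal (poly_ring n) (?h ` E) \<subseteq> ?M" using hM by (rule R.genideal_minimal)
  moreover have "B \<subseteq> genideal (poly_ring n) B" using B(2) by (intro R.genideal_self) simp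
  ultimately have BM: "B \<subseteq> ?M" using gen by simp
  have "ideal ?J (poly_ring n)"
  proof (rule ideal_poly_ringI)
    show "p + q \<in> ?J" if "p \<in> ?J" "q \<in> ?J" for p q
      using that add[of p q] V.span_add[of "quadratic_part p" ?T "quadratic_part q"]
      by (auto simp: quadratic_part_add)
    show "r * p \<in> ?J" if "p \<in> ?J" "r \<in> poly_carrier n" for p r
      using that mult[of p r] V.span_scale[of "quadratic_part p" ?T "lookup r 0"]
      by (auto simp: quadratic_part_mult)
  qed (auto simp: V.span_zero)
  moreover have "B \<subseteq> ?J" using BM by (auto intro: V.span_base)
  ultimately have "genideal (poly_ring n) B \<subseteq> ?J" by (rule R.genideal_minimal)
  moreover have "?h ` E \<subseteq> genideal (poly_ring n) (?h ` E)" using hM by (intro R.genideal_self) auto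
  ultimately have "?h ` E \<subseteq> ?J" using gen by simp
  moreover have "quadratic_part (?h e) = ?h e" for e
  proof (rule quadratic_part_id)
    fix m assume "m \<in> keys (?h e)"
    then have "m \<in> {pair_monom (fst e) (snd e + 1), pair_monom (snd e) (fst e + 1)}"
      using keys_hankel_binomial[of "fst e" "snd e"] by (auto simp: case_prod_beta)
    then show "monom_degree m = 2" by auto
  qed
  ultimately have span: "?h ` E \<subseteq> V.span ?T" by force
  have indep: "\<forall>e\<in>E. u e = 0" if "(\<Sum>e\<in>E. cst (u e) * ?h e) = 0" for u :: "nat \<times> nat \<Rightarrow> 'k"
    using hankel_binomials_independent[OF E(1) _ that] E(2) by blast
  \<comment> \<open>Independence is known for the family indexed by \<open>E\<close>; injectivity
    transfers it to the set of binomials and equates the cardinalities.\<close>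
  have inj: "inj_on ?h E"
  proof (rule inj_onI, rule ccontr)
    fix e e' assume e: "e \<in> E" "e' \<in> E" "?h e = ?h e'" "e \<noteq> e'"
    let ?c = "\<lambda>x. if x = e then 1 else if x = e' then - 1 else (0::'k)"
    have "(\<Sum>x\<in>E. cst (?c x) * ?h x) = (\<Sum>x\<in>{e, e'}. cst (?c x) * ?h x)"
      using e E(1) by (intro sum.mono_neutral_right) auto
    also have "\<dots> = (cst 1 + cst (- 1)) * ?h e'" using e by (simp add: algebra_simps)
    also have "\<dots> = 0" unfolding cst_add[symmetric] by simp
    finally show False using indep[of ?c] e(1) by auto
  qed
  have "V.independent (?h ` E)"
  proof (rule V.independent_if_scalars_zero)
    fix f x assume fx: "(\<Sum>x\<in>?h ` E. cst (f x) * x) = 0" "x \<in> ?h ` E"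
    then have "(\<Sum>e\<in>E. cst (f (?h e)) * ?h e) = 0" by (simp add: sum.reindex[OF inj])
    from indep[OF this] show "f x = 0" using fx(2) by auto
  qed (use E(1) in simp)
  then have "card (?h ` E) \<le> card ?T"
    using V.independent_span_bound[of ?T "?h ` E"] span B(1) by simp
  also have "\<dots> \<le> card B" using B(1) by (rule card_image_le)
  finally show ?thesis by (simp add: card_image[OF inj])
qed

text \<open>Every finite generating set has at least \<open>card E\<close> elements. The binomials
  attain this bound, so no proper subset of them generates.\<close>

lemma mu_hankel_ideal:
  assumes E: "finite E" "\<And>i j. (i, j) \<in> E \<Longrightarrow> 1 \<le> i \<and> i < j \<and> j \<le> n"
  shows "mu n (genideal (poly_ring n) (case_prod hankel_binomial ` E) :: 'k::field mpoly set) = card E"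
  unfolding mu_def
proof (rule Least_equality)
  let ?H = "case_prod hankel_binomial ` E :: 'k mpoly set"
  have carr: "?H \<subseteq> poly_carrier n"
    using E(2) by (force intro!: hankel_binomial_carrier)
  have min: "card E \<le> card C"
    if "C \<subseteq> ?H" "genideal (poly_ring n) C = genideal (poly_ring n) ?H" for C
    using that carr E(1) finite_surj[of E C] finite_subset[of C ?H]
    by (intro card_le_card_generators[OF E]) auto
  \<comment> \<open>The bound applied to \<open>?H\<close> itself shows that distinct pairs have
    distinct binomials.\<close>
  have card: "card ?H = card E"
    using min[of ?H] card_image_le[OF E(1), of "case_prod hankel_binomial :: _ \<Rightarrow> 'k mpoly"] by simp
  have "min_homogeneous_generating_set n (genideal (poly_ring n) ?H) ?H"
    unfolding min_homogeneous_generating_set_def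
  proof (intro conjI allI impI)
    fix C assume C: "C \<subset> ?H"
    then have "card C < card E" using psubset_card_mono[of ?H C] E(1) card by simp
    then show "genideal (poly_ring n) C \<noteq> genideal (poly_ring n) ?H"
      using min[of C] C by auto
  qed (use carr E(1) in \<open>auto simp: homogeneous_hankel_binomial\<close>)
  then show "\<exists>B. min_homogeneous_generating_set n (genideal (poly_ring n) ?H) B \<and> card B = card E"
    using card by blast
next
  fix k
  assume "\<exists>B :: 'k mpoly set. min_homogeneous_generating_set n
    (genideal (poly_ring n) (case_prod hankel_binomial ` E)) B \<and> card B = k"
  then show "card E \<le> k"
    unfolding min_homogeneous_generating_set_def by (auto intro: card_le_card_generators[OF E])
qed

theorem corollary2p5:
  fixes G :: "nat pair_pre_digraph" and n :: nat
  assumes "labeled_semi_Hamiltonian n G"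
    and "Digraph_Component.connected (with_proj G)"
  shows "complete_intersection n (hankel_edge_ideal n G :: 'k::field mpoly set)
         \<longleftrightarrow> G = path_graph n"
proof -
  interpret R: ring "poly_ring n :: 'k mpoly ring" by (rule ring_poly_ring)
  have G: "pair_graph G" "pverts G = {1..n}" "(1, n) \<notin> parcs G"
    and sub: "parcs (path_graph n) \<subseteq> parcs G"
    using assms(1) by (auto simp: labeled_semi_Hamiltonian_def subgraph_def)
  interpret G: pair_graph G by (rule G(1))
  \<comment> \<open>Connectedness excludes the empty graph, so \<open>n - 1\<close> is not
    truncated.\<close>
  have "pverts G \<noteq> {}"
    using assms(2) by (simp add: Digraph_Component.connected_def strongly_connected_def)
  then have n: "1 \<le> n" using G(2) by auto
  \<comment> \<open>Only the increasing arc of each edge is kept, so that \<open>card E\<close>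
    counts undirected edges.\<close>
  define E where "E = {(i, j). i < j \<and> (i, j) \<in> parcs G}"
  define L where "L = (\<lambda>i. (i, i + 1)) ` {1..<n}"
  define H :: "'k mpoly set" where "H = case_prod hankel_binomial ` E"
  have E: "1 \<le> i \<and> i < j \<and> j \<le> n" if "(i, j) \<in> E" for i j
    using that G.arc_fst_in_verts[of "(i, j)"] G.arc_snd_in_verts[of "(i, j)"] G(2)
    by (auto simp: E_def)
  have finE: "finite E"
    by (rule finite_subset[OF _ G.pair_finite_arcs]) (auto simp: E_def)
  have sym: "(j, i) \<in> parcs G" if "(i, j) \<in> parcs G" for i j
    using G.pair_sym_arcs that by (auto simp: symmetric_def dest: symD)
  have LE: "L \<subseteq> E" using sub by (auto simp: L_def E_def path_graph_def)
  have cardL: "card L = n - 1" by (simp add: L_def card_image inj_on_def)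
  have I: "hankel_edge_ideal n G = genideal (poly_ring n) (H :: 'k mpoly set)"
    unfolding hankel_edge_ideal_def H_def E_def by (rule arg_cong[of _ _ "genideal _"]) auto
  have mu: "mu n (hankel_edge_ideal n G :: 'k mpoly set) = card E"
    unfolding I H_def using finE E by (rule mu_hankel_ideal)
  have H_carr: "H \<subseteq> (poly_carrier n :: 'k mpoly set)"
    using E by (force simp: H_def intro!: hankel_binomial_carrier)
  have path_iff: "G = path_graph n \<longleftrightarrow> E = L"
  proof
    assume "E = L"
    have "parcs G \<subseteq> parcs (path_graph n)"
    proof clarify
      fix i j assume ij: "(i, j) \<in> parcs G"
      then have "i \<noteq> j" using G.pair_no_loops[of "(i, j)"] by auto
      then have "(i, j) \<in> L \<or> (j, i) \<in> L"
        using ij sym[OF ij] \<open>E = L\<close>[symmetric] by (auto simp: E_def)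
      then show "(i, j) \<in> parcs (path_graph n)" by (auto simp: L_def path_graph_def)
    qed
    then show "G = path_graph n"
      using sub G(2) by (intro pair_pre_digraph.equality) (auto simp: path_graph_def)
  qed (auto simp: E_def L_def path_graph_def)
  let ?P = "subst_kernel n (vanish {2..n}) :: 'k mpoly set"
  have P: "primeideal ?P (poly_ring n)" by (rule primeideal_subst_kernel)
  have "H \<subseteq> ?P"
  proof (unfold H_def, clarify)
    fix i j assume ij: "(i, j) \<in> E"
    then have "hankel_binomial i j \<in> (poly_carrier n :: 'k mpoly set)"
      using E[OF ij] by (intro hankel_binomial_carrier) auto
    \<comment> \<open>\<open>X j * X (i + 1)\<close> always vanishes, because
      \<open>2 \<le> j \<le> n\<close>; \<open>X i * X (j + 1)\<close> would survive only for the
      excluded edge between \<open>1\<close> and \<open>n\<close>.\<close>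
    moreover have "i \<noteq> 1 \<or> j \<noteq> n" using ij G(3) by (auto simp: E_def)
    then have "subst (vanish {2..n}) (hankel_binomial i j :: 'k mpoly) = 0"
      using E[OF ij] by (auto simp: hankel_binomial_def subst_diff subst_mult vanish_def)
    ultimately show "hankel_binomial i j \<in> ?P" by (simp add: subst_kernel_def)
  qed
  then have "hankel_edge_ideal n G \<subseteq> ?P"
    unfolding I by (intro R.genideal_minimal primeideal_poly_ringD(1)[OF P])
  then have "ideal_height (poly_ring n) (hankel_edge_ideal n G :: 'k mpoly set) \<le> prime_height (poly_ring n) ?P"
    unfolding ideal_height_def using P by (intro Inf_lower) auto
  then have upper: "ideal_height (poly_ring n) (hankel_edge_ideal n G :: 'k mpoly set) \<le> enat (n - 1)"
    using prime_height_coordinate_prime_le[OF n] by (rule order_trans)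
  show ?thesis
  proof (cases "E = L")
    case True
    have "enat (n - 1) \<le> ideal_height (poly_ring n) (hankel_edge_ideal n G :: 'k mpoly set)"
      unfolding ideal_height_def
    proof (rule Inf_greatest)
      fix h assume "h \<in> {prime_height (poly_ring n) Q | Q :: 'k mpoly set.
        primeideal Q (poly_ring n) \<and> hankel_edge_ideal n G \<subseteq> Q}"
      then obtain Q :: "'k mpoly set" where Q: "h = prime_height (poly_ring n) Q"
        "primeideal Q (poly_ring n)" "hankel_edge_ideal n G \<subseteq> Q" by blast
      have "H \<subseteq> Q" using R.genideal_self[of H] H_carr Q(3) by (simp add: I)
      moreover have "hankel_binomial i (i + 1) \<in> H" if "1 \<le> i" "i < n" for i
        unfolding H_def True L_def using that by force
      ultimately show "enat (n - 1) \<le> h"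
        unfolding Q(1) by (intro prime_height_over_path_ge[OF Q(2) n]) blast
    qed
    then have "complete_intersection n (hankel_edge_ideal n G :: 'k mpoly set)"
      using upper by (simp add: complete_intersection_def mu True cardL)
    then show ?thesis using True path_iff by simp
  next
    case False
    then have "card L < card E" using LE finE by (intro psubset_card_mono) auto
    then have "enat (n - 1) < enat (card E)" by (simp add: cardL)
    then have "\<not> complete_intersection n (hankel_edge_ideal n G :: 'k mpoly set)"
      using upper unfolding complete_intersection_def mu by (metis leD)
    then show ?thesis using False path_iff by simp
  qed
qed

end
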